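(* Let $G$ be a connected graph with vertex set $[n]=\{1,\ldots,n\}$ and diameter $d \geq 2$. Then $$\chi_\rho(G) = (d-1) + n - \alpha\bigl(G_*^{[d-1]}\bigr),$$ where $\alpha$ denotes the stability number.
   Context: For a graph $G=(V,E)$, a packing $k$-coloring of $G$ is a partition $V_1,\ldots,V_k$ of $V$ such that for every $i\in\{1,\ldots,k\}$, any two distinct vertices $u,v\in V_i$ are at distance at least $i+1$ in $G$; the packing chromatic number $\chi_\rho(G)$ is the smallest such $k$. For integer $k\ge 1$, $G^k$ is the graph on $V(G)$ in which distinct $u,v$ are adjacent iff $d_G(u,v)\le k$ (so $G^1=G$). For $F\subseteq[n]$, $G^F$ is the graph with vertex set $\{(v,k): v\in V(G),\ k\in F\}$ and edge set $$\bigcup_{k\in F}\{((u,k),(v,k)) : (u,v)\in E(G^k)\}\ \cup \bigcup_{j,k\in F,\ j<k}\{((v,j),(v,k)) : v\in V(G)\}.$$ $G_*^F$ is the graph with vertex set $V(G^F)\cup\{( *,k): k\in F\}$ (where $*$ is a new symbol not in $V(G)$) and edge set $E(G^F)\cup\bigcup_{k\in F}\{(( *,k),(v,k)) : v\in V(G)\}$. For a positive integer $p$, $[p]=\{1,\ldots,p\}$, and $G^{[p]}$, $G_*^{[p]}$ denote $G^F$, $G_*^F$ with $F=[p]$. *)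

theory Defs
  imports "Graph_Theory.Graph_Theory" "HOL-Library.Disjoint_Sets"
begin

text \<open>
  A finite simple graph is a \<open>pair_graph\<close>, i.e. a loop-free symmetric arc relation: the undirected
  edge \<open>uv\<close> is represented by the two arcs \<open>(u, v)\<close> and \<open>(v, u)\<close>.
\<close>

definition gdist :: "'a pair_pre_digraph \<Rightarrow> 'a \<Rightarrow> 'a \<Rightarrow> ereal" where
  "gdist G u v = wf_digraph.\<mu> (with_proj G) (\<lambda>_. 1) u v"

definition gdiameter :: "'a pair_pre_digraph \<Rightarrow> ereal" where
  "gdiameter G = (SUP u\<in>pverts G. SUP v\<in>pverts G. gdist G u v)"

text \<open>
  Colour classes may be empty. This does not affect the least \<open>k\<close>: if class \<open>i < k\<close> is empty, then
  class \<open>k\<close> can be moved there, and if class \<open>k\<close> is empty it can be dropped.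
\<close>

definition packing_coloring :: "'a pair_pre_digraph \<Rightarrow> nat \<Rightarrow> (nat \<Rightarrow> 'a set) \<Rightarrow> bool" where
  "packing_coloring G k V \<longleftrightarrow>
     (\<Union>i\<in>{1..k}. V i) = pverts G \<and>
     disjoint_family_on V {1..k} \<and>
     (\<forall>i\<in>{1..k}. \<forall>u\<in>V i. \<forall>v\<in>V i. u \<noteq> v \<longrightarrow> gdist G u v \<ge> ereal (real (i + 1)))"

definition packing_chromatic_number :: "'a pair_pre_digraph \<Rightarrow> nat" where
  "packing_chromatic_number G = (LEAST k. \<exists>V. packing_coloring G k V)"

definition graph_power :: "'a pair_pre_digraph \<Rightarrow> nat \<Rightarrow> 'a pair_pre_digraph" where
  "graph_power G k =
     \<lparr> pverts = pverts G,
       parcs = {(u, v). u \<in> pverts G \<and> v \<in> pverts G \<and> u \<noteq> v \<and> gdist G u v \<le> ereal (real k)} \<rparr>"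

text \<open>
  The graph $G^F$. Both orientations of every edge are arcs, hence \<open>j \<noteq> k\<close> rather than \<open>j < k\<close>.
\<close>

definition layer_graph :: "'a pair_pre_digraph \<Rightarrow> nat set \<Rightarrow> ('a \<times> nat) pair_pre_digraph" where
  "layer_graph G F =
     \<lparr> pverts = pverts G \<times> F,
       parcs = (\<Union>k\<in>F. {((u, k), (v, k)) | u v. (u, v) \<in> parcs (graph_power G k)}) \<union>
               {((v, j), (v, k)) | v j k. v \<in> pverts G \<and> j \<in> F \<and> k \<in> F \<and> j \<noteq> k} \<rparr>"

text \<open>
  The graph $G_*^F$. The new symbol \<open>*\<close> is \<open>None\<close>, and a vertex \<open>v\<close> of \<open>G\<close> becomes \<open>Some v\<close>.
\<close>

definition star_layer_graph ::
    "'a pair_pre_digraph \<Rightarrow> nat set \<Rightarrow> ('a option \<times> nat) pair_pre_digraph" where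
  "star_layer_graph G F =
     \<lparr> pverts = {(Some v, k) | v k. (v, k) \<in> pverts (layer_graph G F)} \<union> {(None, k) | k. k \<in> F},
       parcs = {((Some u, j), (Some v, k)) | u j v k. ((u, j), (v, k)) \<in> parcs (layer_graph G F)} \<union>
               (\<Union>k\<in>F. {((None, k), (Some v, k)) | v. v \<in> pverts G}) \<union>
               (\<Union>k\<in>F. {((Some v, k), (None, k)) | v. v \<in> pverts G}) \<rparr>"

definition stable_set :: "'a pair_pre_digraph \<Rightarrow> 'a set \<Rightarrow> bool" where
  "stable_set G S \<longleftrightarrow> S \<subseteq> pverts G \<and> (\<forall>u\<in>S. \<forall>v\<in>S. (u, v) \<notin> parcs G)"

definition stability_number :: "'a pair_pre_digraph \<Rightarrow> nat" where
  "stability_number G = Max {card S | S. stable_set G S}"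

lemma gdist_conv_length:
  assumes "pair_graph G"
  shows "gdist G u v =
    (INF p\<in>{p. pre_digraph.awalk (with_proj G) u p v}. ereal (real (length p)))"
proof -
  interpret pair_graph G by fact
  have "awalk_cost (\<lambda>_. 1) p = real (length p)" for p
    by (induction p) auto
  then show ?thesis
    by (simp add: gdist_def \<mu>_def)
qed

lemma gdist_sym:
  assumes "pair_graph G"
  shows "gdist G u v = gdist G v u"
proof -
  interpret pair_graph G by fact
  have le: "gdist G u v \<le> gdist G v u" for u v
    unfolding gdist_conv_length[OF assms]
  proof (rule INF_mono)
    fix p assume "p \<in> {p. awalk v p u}"
    moreover have "length (rev_path p) = length p"
      by (induction p) auto
    ultimately show "\<exists>q\<in>{p. awalk u p v}. ereal (real (length q)) \<le> ereal (real (length p))"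
      by (intro bexI[of _ "rev_path p"]) auto
  qed
  show ?thesis
    by (rule antisym) (rule le)+
qed

lemma pair_graphI_sym:
  assumes "finite (pverts H)" "parcs H \<subseteq> pverts H \<times> pverts H" "sym (parcs H)" "irrefl (parcs H)"
  shows "pair_graph H"
  using assms finite_subset[OF assms(2)]
  by unfold_locales (auto simp: symmetric_def irrefl_def)

lemma pair_graph_graph_power:
  assumes "pair_graph G"
  shows "pair_graph (graph_power G k)"
proof -
  interpret pair_graph G by fact
  show ?thesis
    by (rule pair_graphI_sym)
       (auto simp: graph_power_def sym_def irrefl_def gdist_sym[OF assms])
qed

lemma pair_graph_layer_graph:
  assumes "pair_graph G" "finite F"
  shows "pair_graph (layer_graph G F)"
proof -
  interpret pair_graph G by fact
  show ?thesis
    using assms(2)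
    by (intro pair_graphI_sym)
       (auto simp: layer_graph_def graph_power_def sym_def irrefl_def gdist_sym[OF assms(1)])
qed

lemma pair_graph_star_layer_graph:
  assumes "pair_graph G" "finite F"
  shows "pair_graph (star_layer_graph G F)"
proof -
  interpret pair_graph G by fact
  have "pverts (star_layer_graph G F) = (Some ` pverts G \<union> {None}) \<times> F"
    by (auto simp: star_layer_graph_def layer_graph_def)
  then have "finite (pverts (star_layer_graph G F))"
    using assms(2) by simp
  then show ?thesis
    by (intro pair_graphI_sym)
       (auto simp: star_layer_graph_def layer_graph_def graph_power_def sym_def irrefl_def
          gdist_sym[OF assms(1)])
qed

end

theory Submission
  imports Defs
begin

text \<open>
  A stable set of the star layer graph is a choice of pairwise disjoint packings \<open>V\<^sub>1, \<dots>, V\<^sub>d\<^sub>-\<^sub>1\<close>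
  together with a set of layers \<open>i\<close>, all having \<open>V\<^sub>i\<close> empty, marked by \<open>*\<close>. Giving each uncovered
  vertex a colour of its own and then closing the gaps at the marked layers costs exactly
  \<open>(d - 1) + n\<close> minus the size of the stable set. Conversely, in a packing coloring a class of
  index at least \<open>d\<close> has at most one vertex, so truncating the coloring to the first \<open>d - 1\<close>
  classes loses at most one vertex for each further colour.
\<close>

section \<open>Stability number and distances\<close>

lemma finite_stable_sets:
  assumes "finite (pverts H)"
  shows "finite {card S | S. stable_set H S}"
proof -
  have "{card S | S. stable_set H S} \<subseteq> card ` Pow (pverts H)"
    by (auto simp: stable_set_def)
  then show ?thesis
    using assms finite_subset by blast
qed

lemma stability_number_ge:
  assumes "finite (pverts H)" "stable_set H S"
  shows "card S \<le> stability_number H"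
  unfolding stability_number_def using assms by (intro Max_ge finite_stable_sets) auto

lemma stability_number_attained:
  assumes "finite (pverts H)"
  obtains S where "stable_set H S" "card S = stability_number H"
proof -
  have "stable_set H {}"
    by (simp add: stable_set_def)
  then have "stability_number H \<in> {card S | S. stable_set H S}"
    unfolding stability_number_def using assms by (intro Max_in finite_stable_sets) auto
  with that show thesis
    by auto
qed

lemma pverts_star_layer_graph:
  "pverts (star_layer_graph G F) = (Some ` pverts G \<union> {None}) \<times> F"
  by (auto simp: star_layer_graph_def layer_graph_def)

lemma gdist_le_gdiameter:
  assumes "u \<in> pverts G" "v \<in> pverts G"
  shows "gdist G u v \<le> gdiameter G"
  unfolding gdiameter_def using assms by (meson SUP_upper2 order_refl)

text \<open>The distance is an infimum of walk lengths, all natural numbers, so a value above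
  \<open>k\<close> means that every walk has at least \<open>k + 1\<close> arcs; without walks it is
  infinite.\<close>

lemma gdist_ge_Suc:
  assumes "pair_graph G" "\<not> gdist G u v \<le> ereal (real k)"
  shows "gdist G u v \<ge> ereal (real (k + 1))"
  unfolding gdist_conv_length[OF assms(1)]
proof (rule INF_greatest)
  fix p assume "p \<in> {p. pre_digraph.awalk (with_proj G) u p v}"
  then have "gdist G u v \<le> ereal (real (length p))"
    unfolding gdist_conv_length[OF assms(1)] by (rule INF_lower)
  with assms(2) have "\<not> length p \<le> k"
    by (metis ereal_less_eq(3) of_nat_le_iff order_trans)
  then show "ereal (real (k + 1)) \<le> ereal (real (length p))"
    by simp
qed

section \<open>Closing gaps in a packing coloring\<close>

text \<open>The last class meets the strongest distance requirement, so it can take over the index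
  of any empty class. For \<open>i = Suc k\<close> the update lies outside \<open>{1..k}\<close> and
  the empty class is just dropped.\<close>

lemma packing_coloring_decrease:
  assumes col: "packing_coloring G (Suc k) V" and i: "i \<in> {1..Suc k}" "V i = {}"
  shows "packing_coloring G k (V(i := V (Suc k)))"
proof -
  let ?W = "V(i := V (Suc k))"
  have "(\<Union>j\<in>{1..k}. ?W j) = (\<Union>j\<in>{1..Suc k}. V j)"
  proof (intro equalityI subsetI)
    fix x assume "x \<in> (\<Union>j\<in>{1..Suc k}. V j)"
    then obtain j where j: "j \<in> {1..Suc k}" "x \<in> V j" "j \<noteq> i"
      using i by blast
    show "x \<in> (\<Union>j\<in>{1..k}. ?W j)"
    proof (cases "j = Suc k")
      case True
      then show ?thesis using i j by (intro UN_I[of i]) auto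
    next
      case False
      then show ?thesis using j by (intro UN_I[of j]) auto
    qed
  qed (auto split: if_splits)
  moreover have "disjoint_family_on ?W {1..k}"
    using col unfolding packing_coloring_def disjoint_family_on_def by auto
  moreover have "gdist G u v \<ge> ereal (real (j + 1))"
    if "j \<in> {1..k}" "u \<in> ?W j" "v \<in> ?W j" "u \<noteq> v" for j u v
  proof (cases "j = i")
    case True
    then have "gdist G u v \<ge> ereal (real (Suc k + 1))"
      using that col unfolding packing_coloring_def
      by (metis atLeastAtMost_iff fun_upd_same le_add1 le_refl plus_1_eq_Suc)
    moreover have "ereal (real (j + 1)) \<le> ereal (real (Suc k + 1))"
      using that by simp
    ultimately show ?thesis
      by (rule order_trans[rotated])
  next
    case False
    then show ?thesis
      using that col unfolding packing_coloring_def by auto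
  qed
  ultimately show ?thesis
    using col unfolding packing_coloring_def by auto
qed

text \<open>Gaps are closed from the largest index down: the remaining ones then lie in the
  shortened range and are untouched by the move of the last class.\<close>

lemma packing_coloring_remove_empty:
  assumes "packing_coloring G k V" "E \<subseteq> {1..k}" "\<And>i. i \<in> E \<Longrightarrow> V i = {}"
  shows "\<exists>W. packing_coloring G (k - card E) W"
  using assms
proof (induction k arbitrary: V E)
  case 0
  then show ?case by auto
next
  case (Suc k)
  show ?case
  proof (cases "E = {}")
    case True
    with Suc.prems show ?thesis by auto
  next
    case False
    \<comment> \<open>Taking the largest element covers the case \<open>Suc k \<in> E\<close>, where the last class is just dropped.\<close>
    define i where "i = Max E"
    have fin: "finite E"
      using Suc.prems(2) finite_subset by blast
    then have i: "i \<in> E" "\<And>j. j \<in> E \<Longrightarrow> j \<le> i"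
      using False unfolding i_def by auto
    have sub: "E - {i} \<subseteq> {1..k}"
      using i Suc.prems(2) by (force simp: subset_iff)
    have "packing_coloring G k (V(i := V (Suc k)))"
      using Suc.prems i by (intro packing_coloring_decrease) auto
    then have "\<exists>W. packing_coloring G (k - card (E - {i})) W"
      using sub
    proof (rule Suc.IH)
      show "(V(i := V (Suc k))) j = {}" if "j \<in> E - {i}" for j
        using that Suc.prems(3) by simp
    qed
    moreover have "card E = Suc (card (E - {i}))"
      using fin i by (metis card.remove)
    ultimately show ?thesis by simp
  qed
qed

section \<open>From stable sets to colorings\<close>

lemma stable_set_imp_packing_coloring:
  assumes G: "pair_graph G" and "d \<ge> 1"
    and S: "stable_set (star_layer_graph G {1..d - 1}) S"
  shows "\<exists>k W. packing_coloring G k W \<and> k + card S = d - 1 + card (pverts G)"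
proof -
  interpret pair_graph G by fact
  define A where "A = {v. \<exists>i. (Some v, i) \<in> S}"
  define E where "E = {i. (None, i) \<in> S}"
  define T where "T = {x \<in> S. fst x \<noteq> None}"
  have S_verts: "S \<subseteq> (Some ` pverts G \<union> {None}) \<times> {1..d - 1}"
    using S by (simp add: stable_set_def pverts_star_layer_graph)
  have S_arcs: "(x, y) \<notin> parcs (star_layer_graph G {1..d - 1})" if "x \<in> S" "y \<in> S" for x y
    using S that by (auto simp: stable_set_def)
  have A_sub: "A \<subseteq> pverts G" and E_sub: "E \<subseteq> {1..d - 1}"
    using S_verts by (auto simp: A_def E_def)
  have fin: "finite A" "finite E" "finite S"
    using A_sub E_sub S_verts
    by (auto intro: finite_subset[OF _ finite_verts] finite_subset[OF S_verts] finite_subset)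
  \<comment> \<open>Each kind of arc gives one property: arcs between copies of a vertex a unique
    layer, arcs within a layer the packing condition, arcs at \<open>None\<close> the emptiness of
    marked layers.\<close>
  have uniq: "i = j" if "(Some v, i) \<in> S" "(Some v, j) \<in> S" for v i j
    using S_arcs[OF that] S_verts that by (auto simp: star_layer_graph_def layer_graph_def)
  have packing: "\<not> gdist G u v \<le> ereal (real i)"
    if "(Some u, i) \<in> S" "(Some v, i) \<in> S" "u \<noteq> v" for u v i
    using S_arcs[OF that(1,2)] S_verts that
    by (auto simp: star_layer_graph_def layer_graph_def graph_power_def)
  have star: "(Some v, i) \<notin> S" if "(None, i) \<in> S" for v i
    using S_arcs[OF that, of "(Some v, i)"] S_verts that
    by (auto simp: star_layer_graph_def layer_graph_def)
  have "card S = card A + card E"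
  proof -
    have "inj_on fst T"
      using uniq by (auto simp: T_def inj_on_def)
    moreover have "fst ` T = Some ` A"
      by (force simp: T_def A_def)
    ultimately have "card T = card A"
      by (metis card_image inj_Some)
    moreover have "S = T \<union> Pair None ` E" "T \<inter> Pair None ` E = {}"
      by (auto simp: T_def E_def)
    moreover have "card (Pair (None :: 'a option) ` E) = card E"
      by (intro card_image inj_onI) auto
    moreover have "finite T" "finite (Pair (None :: 'a option) ` E)"
      using fin by (simp_all add: T_def)
    ultimately show ?thesis
      using card_Un_disjoint by metis
  qed
  define U where "U = pverts G - A"
  have card_U: "card (pverts G) = card A + card U"
    using A_sub fin unfolding U_def
    by (simp add: card_Diff_subset card_mono)
  \<comment> \<open>The uncovered vertices receive the fresh colours from \<open>d\<close> on, one
    each; singleton classes satisfy every distance condition.\<close>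
  obtain f where f: "bij_betw f {d..<d + card U} U"
    using finite_same_card_bij[of "{d..<d + card U}" U] finite_verts unfolding U_def by auto
  define V where "V i = (if i < d then {v. (Some v, i) \<in> S} else {f i})" for i
  let ?k = "d - 1 + card U"
  have k: "{1..?k} = {1..d - 1} \<union> {d..<d + card U}"
    using \<open>d \<ge> 1\<close> by auto
  have "(\<Union>i\<in>{1..?k}. V i) = pverts G"
  proof -
    have "(\<Union>i\<in>{1..d - 1}. V i) = A"
    proof (intro equalityI subsetI)
      fix v assume "v \<in> A"
      then obtain i where "(Some v, i) \<in> S"
        by (auto simp: A_def)
      then show "v \<in> (\<Union>i\<in>{1..d - 1}. V i)"
        using S_verts by (intro UN_I[of i]) (fastforce simp: V_def)+
    qed (auto simp: V_def A_def split: if_splits)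
    moreover have "(\<Union>i\<in>{d..<d + card U}. V i) = U"
      using f by (auto simp: V_def bij_betw_def)
    ultimately show ?thesis
      unfolding k using A_sub by (auto simp: U_def)
  qed
  moreover have "disjoint_family_on V {1..?k}"
  proof -
    have f_notin: "f i \<notin> A" if "i \<in> {1..?k}" "\<not> i < d" for i
      using f that \<open>d \<ge> 1\<close> by (force simp: bij_betw_def U_def)
    have "i = j" if "i \<in> {1..?k}" "j \<in> {1..?k}" "\<not> i < d" "\<not> j < d" "f i = f j" for i j
      using f that \<open>d \<ge> 1\<close> by (auto simp: bij_betw_def inj_on_def)
    then have "i = j" if "i \<in> {1..?k}" "j \<in> {1..?k}" "x \<in> V i" "x \<in> V j" for i j x
      using that uniq f_notin by (auto simp: V_def A_def split: if_splits)
    then show ?thesis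
      unfolding disjoint_family_on_def by blast
  qed
  moreover have "gdist G u v \<ge> ereal (real (i + 1))"
    if "u \<in> V i" "v \<in> V i" "u \<noteq> v" for i u v
    using that packing gdist_ge_Suc[OF G] by (auto simp: V_def split: if_splits)
  ultimately have "packing_coloring G ?k V"
    by (simp add: packing_coloring_def)
  moreover have "E \<subseteq> {1..?k}"
    using E_sub by auto
  moreover have "V i = {}" if "i \<in> E" for i
  proof -
    have "i \<in> {1..d - 1}"
      using that E_sub by blast
    then show ?thesis
      using that star by (auto simp: V_def E_def)
  qed
  ultimately have "\<exists>W. packing_coloring G (?k - card E) W"
    by (rule packing_coloring_remove_empty)
  \<comment> \<open>This keeps the natural-number subtraction \<open>?k - card E\<close> exact, so
    that \<open>card E\<close> cancels against its share in \<open>card S\<close>.\<close>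
  moreover have "card E \<le> d - 1"
    using card_mono[OF _ E_sub] by simp
  then have "?k - card E + card S = d - 1 + card (pverts G)"
    using \<open>card S = _\<close> card_U by simp
  ultimately show ?thesis
    by blast
qed

section \<open>From colorings to stable sets\<close>

lemma packing_coloring_imp_stable_set:
  assumes G: "pair_graph G" and diam: "gdiameter G \<le> ereal (real d)" and "d \<ge> 1"
    and col: "packing_coloring G k V"
  shows "\<exists>S. stable_set (star_layer_graph G {1..d - 1}) S \<and>
    d - 1 + card (pverts G) \<le> card S + k"
proof -
  interpret pair_graph G by fact
  have "\<forall>v\<in>pverts G. \<exists>i. i \<in> {1..k} \<and> v \<in> V i"
    using col unfolding packing_coloring_def by blast
  then obtain c where c: "\<And>v. v \<in> pverts G \<Longrightarrow> c v \<in> {1..k} \<and> v \<in> V (c v)"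
    by metis
  have far: "gdist G u v \<ge> ereal (real (c u + 1))"
    if "u \<in> pverts G" "v \<in> pverts G" "u \<noteq> v" "c u = c v" for u v
    using col c[OF that(1)] c[OF that(2)] that unfolding packing_coloring_def by auto
  define A where "A = {v \<in> pverts G. c v \<le> d - 1}"
  \<comment> \<open>If \<open>k < d - 1\<close>, the layers above \<open>k\<close> hold no vertex
    and can all be marked; otherwise the second set is empty.\<close>
  define S where "S = (\<lambda>v. (Some v, c v)) ` A \<union> Pair None ` {k + 1..d - 1}"
  have "stable_set (star_layer_graph G {1..d - 1}) S"
    unfolding stable_set_def
  proof (intro conjI ballI)
    show "S \<subseteq> pverts (star_layer_graph G {1..d - 1})"
      unfolding pverts_star_layer_graph S_def A_def using c by force
    have near: "\<not> gdist G u v \<le> ereal (real (c v))"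
      if "u \<in> pverts G" "v \<in> pverts G" "u \<noteq> v" "c u = c v" for u v
    proof
      assume "gdist G u v \<le> ereal (real (c v))"
      with far[OF that] have "ereal (real (c v + 1)) \<le> ereal (real (c v))"
        using that(4) by (metis order_trans)
      then show False by simp
    qed
    show "(x, y) \<notin> parcs (star_layer_graph G {1..d - 1})" if "x \<in> S" "y \<in> S" for x y
      using that c near
      by (fastforce simp: S_def A_def star_layer_graph_def layer_graph_def graph_power_def)
  qed
  moreover have "card S = card A + (d - 1 - k)"
  proof -
    have "card ((\<lambda>v. (Some v, c v)) ` A) = card A"
      by (intro card_image inj_onI) auto
    moreover have "card (Pair (None :: 'a option) ` {k + 1..d - 1}) = d - 1 - k"
      by (subst card_image) (auto intro: inj_onI)
    moreover have "finite A"
      using finite_verts by (simp add: A_def)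
    ultimately show ?thesis
      unfolding S_def by (subst card_Un_disjoint) auto
  qed
  moreover have "card (pverts G) = card A + card (pverts G - A)"
    by (simp add: A_def card_Diff_subset card_mono)
  moreover have "card (pverts G - A) \<le> Suc k - d"
  proof -
    \<comment> \<open>Two vertices sharing a colour of at least \<open>d\<close> would be at
      distance at least \<open>d + 1\<close>, beyond the diameter.\<close>
    have "inj_on c (pverts G - A)"
    proof (rule inj_onI, rule ccontr)
      fix u v assume uv: "u \<in> pverts G - A" "v \<in> pverts G - A" "c u = c v" "u \<noteq> v"
      then have "ereal (real (c u + 1)) \<le> gdist G u v"
        by (intro far) auto
      also have "\<dots> \<le> ereal (real d)"
        using gdist_le_gdiameter[of u G v] diam uv by (auto intro: order_trans)
      finally have "c u + 1 \<le> d"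
        by (metis ereal_less_eq(3) of_nat_le_iff)
      then show False
        using uv by (auto simp: A_def)
    qed
    moreover have "c ` (pverts G - A) \<subseteq> {d..k}"
      using c by (force simp: A_def)
    ultimately have "card (pverts G - A) \<le> card {d..k}"
      by (intro card_inj_on_le) auto
    then show ?thesis by simp
  qed
  ultimately show ?thesis
    \<comment> \<open>For \<open>k < d - 1\<close> no vertex is lost and the marks supply
      \<open>d - 1 - k\<close>; otherwise there are no marks and at most \<open>k - (d - 1)\<close>
      vertices are lost.\<close>
    using \<open>d \<ge> 1\<close> by (intro exI[of _ S]) auto
qed

theorem theorem2:
  fixes G :: "nat pair_pre_digraph" and n d :: nat
  assumes "pair_graph G"
    and "pverts G = {1..n}"
    and "Digraph_Component.connected (with_proj G)"
    and "gdiameter G = ereal (real d)"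
    and "d \<ge> 2"
  shows "int (packing_chromatic_number G) =
    (int d - 1) + int n - int (stability_number (star_layer_graph G {1..d - 1}))"
proof -
  let ?H = "star_layer_graph G {1..d - 1}"
  let ?\<alpha> = "stability_number ?H"
  have card_G: "card (pverts G) = n"
    using assms(2) by simp
  have fin: "finite (pverts ?H)"
    using assms(2) by (simp add: pverts_star_layer_graph)
  have lower: "d - 1 + n \<le> ?\<alpha> + k" if col: "packing_coloring G k V" for k V
  proof -
    obtain S where "stable_set ?H S" "d - 1 + n \<le> card S + k"
      using packing_coloring_imp_stable_set[OF assms(1) _ _ col] assms(4,5) card_G by fastforce
    with stability_number_ge[OF fin] show ?thesis by fastforce
  qed
  obtain S where "stable_set ?H S" "card S = ?\<alpha>"
    using stability_number_attained[OF fin] .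
  \<comment> \<open>A maximum stable set yields a coloring that meets the bound \<open>lower\<close>
    with equality, so its \<open>k\<close> is least.\<close>
  then obtain k W where k: "packing_coloring G k W" "k + ?\<alpha> = d - 1 + n"
    using stable_set_imp_packing_coloring[OF assms(1), of d S] assms(5) card_G by auto
  have "packing_chromatic_number G = k"
    unfolding packing_chromatic_number_def
    using k lower by (intro Least_equality) fastforce+
  then show ?thesis
    using k(2) assms(5) by linarith
qed

end
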